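(* Let $n\ge 1$ be an integer, let $f,g:\mathbb{R}^n\times[0,\infty)^2\times\mathbb{R}^n\times\mathbb{R}^n\to\mathbb{R}$ be nonnegative functions, and consider the system $$\begin{cases}-\Delta u=f(x,u,v,\nabla u,\nabla v) & \text{in } \mathbb{R}^n,\\ -\Delta v=g(x,u,v,\nabla u,\nabla v) & \text{in } \mathbb{R}^n.\end{cases}$$ (i) Assume that, for each $M>0$, there exists a constant $K=K(M)>0$ such that, for all $x\in\mathbb{R}^n$ and all $(u,v,\xi,\zeta)\in[0,M]^2\times\mathbb{R}^n\times\mathbb{R}^n$, $$u\,f(x,u,v,\xi,\zeta)\le K(M)|\xi|^2\quad\text{and}\quad v\,g(x,u,v,\xi,\zeta)\le K(M)|\zeta|^2.$$ Then any nonnegative, bounded, classical solution $(u,v)$ of the system must be constant. (ii) Assume that, for each $M>0$, there exists a constant $K=K(M)>0$ such that, for all $x\in\mathbb{R}^n$ and all $(u,v,\xi,\zeta)\in[0,M]^2\times B_M\times B_M$, $$u\,f(x,u,v,\xi,\zeta)\le K(M)|\xi|^2\quad\text{and}\quad v\,g(x,u,v,\xi,\zeta)\le K(M)|\zeta|^2.$$ Let $(u,v)$ be a nonnegative classical solution of the system such that $u$, $v$, $|\nabla u|$, $|\nabla v|$ are bounded. Then $(u,v)$ must be constant.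
   Context: A nonnegative classical solution $(u,v)$ means a pair of functions $u,v\in C^2(\mathbb{R}^n)$ with $u,v\ge 0$ on $\mathbb{R}^n$ satisfying both equations pointwise, with $u,v,\nabla u,\nabla v$ evaluated at $x$; it is bounded if $u$ and $v$ are bounded, and constant if both $u$ and $v$ are constant functions. $B_M$ denotes the ball of radius $M$ centered at the origin in $\mathbb{R}^n$, and $|\cdot|$ is the Euclidean norm. No regularity of $f,g$ is assumed. *)

theory Defs
  imports "HOL-Analysis.Analysis"
begin

definition partial_deriv :: "'n \<Rightarrow> (real^'n \<Rightarrow> real) \<Rightarrow> real^'n \<Rightarrow> real" where
  "partial_deriv i u x = frechet_derivative u (at x) (axis i 1)"

definition gradient :: "(real^'n \<Rightarrow> real) \<Rightarrow> real^'n \<Rightarrow> real^'n" where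
  "gradient u x = (\<chi> i. partial_deriv i u x)"

definition laplacian :: "(real^'n \<Rightarrow> real) \<Rightarrow> real^'n \<Rightarrow> real" where
  "laplacian u x = (\<Sum>i\<in>UNIV. partial_deriv i (partial_deriv i u) x)"

(* Differentiability is required explicitly because frechet_derivative is an unspecified choice
   where u is not differentiable. For continuous partials it holds automatically, so C1_fun
   and C2_fun are the usual classes on the whole space. *)
definition C1_fun :: "(real^'n \<Rightarrow> real) \<Rightarrow> bool" where
  "C1_fun u \<longleftrightarrow> (\<forall>x. u differentiable (at x)) \<and> (\<forall>i. continuous_on UNIV (partial_deriv i u))"

definition C2_fun :: "(real^'n \<Rightarrow> real) \<Rightarrow> bool" where
  "C2_fun u \<longleftrightarrow> C1_fun u \<and> (\<forall>i. C1_fun (partial_deriv i u))"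

(* f and g are total in Isabelle/HOL, but only their values at nonnegative second and third
   arguments enter, since u and v are nonnegative. *)
definition nonneg_classical_solution ::
  "(real^'n \<Rightarrow> real \<Rightarrow> real \<Rightarrow> real^'n \<Rightarrow> real^'n \<Rightarrow> real) \<Rightarrow>
   (real^'n \<Rightarrow> real \<Rightarrow> real \<Rightarrow> real^'n \<Rightarrow> real^'n \<Rightarrow> real) \<Rightarrow>
   (real^'n \<Rightarrow> real) \<Rightarrow> (real^'n \<Rightarrow> real) \<Rightarrow> bool" where
  "nonneg_classical_solution f g u v \<longleftrightarrow>
     C2_fun u \<and> C2_fun v \<and> (\<forall>x. 0 \<le> u x) \<and> (\<forall>x. 0 \<le> v x) \<and>
     (\<forall>x. - laplacian u x = f x (u x) (v x) (gradient u x) (gradient v x)) \<and>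
     (\<forall>x. - laplacian v x = g x (u x) (v x) (gradient u x) (gradient v x))"

lemma has_derivative_imp_partial_deriv:
  fixes u :: "real^'n \<Rightarrow> real"
  assumes "(u has_derivative u') (at x)"
  shows "partial_deriv i u x = u' (axis i 1)"
  using frechet_derivative_at[OF assms] by (simp add: partial_deriv_def)

lemma GDERIV_gradient:
  fixes u :: "real^'n \<Rightarrow> real"
  assumes "u differentiable (at x)"
  shows "GDERIV u x :> gradient u x"
proof -
  obtain u' where u': "(u has_derivative u') (at x)"
    using assms by (auto simp: differentiable_def)
  then interpret bounded_linear u'
    by (rule has_derivative_bounded_linear)
  have "u' h = h \<bullet> gradient u x" for h
  proof -
    have "u' h = u' (\<Sum>i\<in>UNIV. h $ i *\<^sub>R axis i 1)"
      by (simp add: basis_expansion flip: scalar_mult_eq_scaleR)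
    also have "\<dots> = (\<Sum>i\<in>UNIV. h $ i * partial_deriv i u x)"
      by (simp add: sum scaleR has_derivative_imp_partial_deriv[OF u'])
    finally show ?thesis
      by (simp add: gradient_def inner_vec_def)
  qed
  then have "u' = (\<lambda>h. h \<bullet> gradient u x)" ..
  with u' show ?thesis
    by (simp add: gderiv_def)
qed

end

(* Every component u is a bounded nonnegative superharmonic function. The growth condition gives
   Laplacian(u^m) = m u^(m-2) (u Laplacian(u) + (m-1) |grad u|^2) >= 0 once m >= K+1, so u^m is
   subharmonic. Weighted means of u over large balls are asymptotically independent of the centre,
   hence comparing the mean of u^m <= (sup u)^(m-1) u around y with that of u around x yields
   u(y)^m <= (sup u)^(m-1) u(x) for all x, y. Taking the supremum over y gives sup u <= u(x).
   The means use the weight (1 - |z|^2)_+ because the divergence theorem then reduces to the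
   translation invariance of the integral of a compactly supported function. *)

theory Submission
  imports Defs
begin

section \<open>The weight, its square, and the divergence theorem on a box\<close>

definition bump :: "real^'n \<Rightarrow> real" where
  "bump z = max 0 (1 - z \<bullet> z)"

text \<open>The box contains the ball of radius 2, so a function supported in the unit ball can be
  translated by up to distance 1 without its support leaving the box. A \<open>cbox\<close> serves
  here because integrability of continuous functions and differentiation under the integral are
  applied on it.\<close>

definition bump_box :: "(real^'n) set" where
  "bump_box = cbox (- 2 *\<^sub>R One) (2 *\<^sub>R One)"

lemma bump_nonneg: "0 \<le> bump z"
  by (simp add: bump_def)

lemma bump_eq_0: "1 \<le> norm z \<Longrightarrow> bump z = 0"
  by (simp add: bump_def norm_eq_sqrt_inner)

lemma continuous_on_bump [continuous_intros]:
  "continuous_on S p \<Longrightarrow> continuous_on S (\<lambda>x. bump (p x))"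
  unfolding bump_def by (intro continuous_intros)

text \<open>Squaring smooths the corner of the truncation: at 0 the difference quotient is at most
  |h| in absolute value, and elsewhere the function is locally either s^2 or 0.\<close>

lemma DERIV_max_0_square: "((\<lambda>s. (max 0 s)\<^sup>2) has_field_derivative 2 * max 0 t) (at (t::real))"
proof (cases "t = 0")
  case True
  have "((\<lambda>h. (max 0 h)\<^sup>2 / h) \<longlongrightarrow> 0) (at (0::real))"
  proof (rule tendsto_0_le[where K = 1])
    show "((\<lambda>h::real. h) \<longlongrightarrow> 0) (at 0)"
      by (rule tendsto_ident_at)
    show "\<forall>\<^sub>F h::real in at 0. norm ((max 0 h)\<^sup>2 / h) \<le> norm h * 1"
      by (intro always_eventually) (auto simp: max_def power2_eq_square)
  qed
  then show ?thesis
    using True by (simp add: DERIV_def)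
next
  case False
  have "((\<lambda>s. (if 0 < t then s\<^sup>2 else 0)) has_field_derivative 2 * max 0 t) (at t)"
    using False by (cases "0 < t") (auto intro!: derivative_eq_intros)
  moreover have "\<forall>\<^sub>F s in nhds t. (if 0 < t then s\<^sup>2 else 0) = (max 0 s)\<^sup>2"
  proof (cases "0 < t")
    case True
    then have "\<forall>\<^sub>F s in nhds t. 0 < s"
      by (intro eventually_nhds_in_open[of "{0<..}", simplified]) auto
    then show ?thesis
      by eventually_elim (use True in auto)
  next
    case False
    with \<open>t \<noteq> 0\<close> have "\<forall>\<^sub>F s in nhds t. s < 0"
      by (intro eventually_nhds_in_open[of "{..<0}", simplified]) auto
    then show ?thesis
      by eventually_elim (use False in auto)
  qed
  ultimately show ?thesis
    by (subst (asm) DERIV_cong_ev) auto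
qed

lemma has_derivative_bump_square:
  "((\<lambda>z. (bump z)\<^sup>2) has_derivative (\<lambda>h. - 4 * bump z * (z \<bullet> h))) (at z)"
proof -
  have "((\<lambda>z. 1 - z \<bullet> z) has_derivative (\<lambda>h. - 2 * (z \<bullet> h))) (at z)"
    by (auto intro!: derivative_eq_intros simp: inner_commute)
  from has_derivative_compose[OF this DERIV_max_0_square[unfolded has_field_derivative_def]]
  show ?thesis
    by (simp add: bump_def algebra_simps)
qed

lemma norm_le_2_imp_in_bump_box: "norm (z::real^'n) \<le> 2 \<Longrightarrow> z \<in> bump_box"
  by (auto simp: bump_box_def mem_box abs_le_iff dest!: order_trans[OF Basis_le_norm])

text \<open>Both \<open>F\<close> and its translate vanish outside the ball of radius 2, hence
  outside the box. Their integrals over the box are therefore integrals over the whole space, which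
  is translation invariant.\<close>

lemma integral_bump_box_translation:
  fixes F :: "real^'n \<Rightarrow> real"
  assumes F: "continuous_on UNIV F" and supp: "\<And>z. 1 \<le> norm z \<Longrightarrow> F z = 0" and h: "norm h \<le> 1"
  shows "integral bump_box (\<lambda>z. F (z + h)) = integral bump_box F"
proof -
  have in_box: "F z = 0" "F (z + h) = 0" if "z \<notin> bump_box" for z
  proof -
    have "2 < norm z"
      using that norm_le_2_imp_in_bump_box not_less by blast
    moreover have "norm z \<le> norm (z + h) + norm h"
      by (metis add_diff_cancel_right' norm_triangle_ineq4)
    ultimately show "F z = 0" "F (z + h) = 0"
      using h by (auto intro!: supp)
  qed
  have "F integrable_on bump_box"
    unfolding bump_box_def by (intro integrable_continuous continuous_on_subset[OF F]) auto
  then have I: "(F has_integral integral bump_box F) bump_box" (is "(_ has_integral ?I) _")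
    by blast
  \<comment> \<open>Translation moves the box as well. The translate of \<open>F\<close> vanishes
    outside either box, so the integral passes from the moved box to the whole space and back to
    \<open>bump_box\<close>.\<close>
  then have "((\<lambda>z. F (z + h)) has_integral ?I) (cbox (- 2 *\<^sub>R One - h) (2 *\<^sub>R One - h))"
    unfolding bump_box_def by (rule has_integral_shift_cbox)
  then have "((\<lambda>z. F (z + h)) has_integral ?I) UNIV"
  proof (rule has_integral_on_superset)
    fix z assume "z \<notin> cbox (- 2 *\<^sub>R One - h) (2 *\<^sub>R One - h)"
    then have "z + h \<notin> bump_box"
      unfolding bump_box_def mem_box by (auto simp: algebra_simps)
    then show "F (z + h) = 0"
      using in_box by blast
  qed auto
  moreover have "(\<lambda>z. if z \<in> bump_box then F (z + h) else 0) = (\<lambda>z. F (z + h))"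
    using in_box by auto
  ultimately have "((\<lambda>z. F (z + h)) has_integral ?I) bump_box"
    by (subst has_integral_restrict_UNIV[symmetric]) simp
  then show ?thesis
    by (rule integral_unique)
qed

text \<open>The integral of \<open>F (z + t *\<^sub>R e)\<close> over the box does not depend on t
  for |t| < 1, since the shift then has norm below 1. Differentiating under the integral at t = 0
  gives the claim. For a coordinate direction this is the divergence theorem for a compactly
  supported function.\<close>

lemma integral_directional_deriv_eq_0:
  fixes F :: "real^'n \<Rightarrow> real"
  assumes F: "\<And>z. (F has_derivative F' z) (at z)" and supp: "\<And>z. 1 \<le> norm z \<Longrightarrow> F z = 0"
    and cont: "continuous_on UNIV (\<lambda>z. F' z e)" and e: "norm e = 1"
  shows "integral bump_box (\<lambda>z. F' z e) = 0"
proof -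
  have cF: "continuous_on UNIV F"
    by (auto simp: continuous_on_eq_continuous_within intro: has_derivative_continuous[OF F])
  have "((\<lambda>t. integral bump_box (\<lambda>z. F (z + t *\<^sub>R e))) has_field_derivative
      integral bump_box (\<lambda>z. F' (z + 0 *\<^sub>R e) e)) (at 0 within ball 0 1)"
    unfolding bump_box_def
  proof (rule leibniz_rule_field_derivative)
    fix t :: real and z :: "real^'n"
    have *: "((\<lambda>t. z + t *\<^sub>R e) has_derivative (\<lambda>s. s *\<^sub>R e)) (at t within ball 0 1)"
      by (auto intro!: derivative_eq_intros)
    have "((\<lambda>t. F (z + t *\<^sub>R e)) has_derivative (\<lambda>s. F' (z + t *\<^sub>R e) (s *\<^sub>R e))) (at t within ball 0 1)"
      by (rule has_derivative_compose[OF * F])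
    moreover have "F' (z + t *\<^sub>R e) (s *\<^sub>R e) = F' (z + t *\<^sub>R e) e * s" for s
      using linear_scale[OF has_derivative_linear[OF F]] by simp
    ultimately show "((\<lambda>t. F (z + t *\<^sub>R e)) has_field_derivative F' (z + t *\<^sub>R e) e) (at t within ball 0 1)"
      by (simp add: has_field_derivative_def)
  next
    show "continuous_on (ball 0 1 \<times> cbox (- 2 *\<^sub>R One) (2 *\<^sub>R One))
       (\<lambda>(t, z). F' (z + t *\<^sub>R e) e)"
      unfolding case_prod_unfold
      by (rule continuous_on_compose2[OF cont]) (auto intro!: continuous_intros)
  qed (auto intro!: integrable_continuous continuous_on_compose2[OF cF] continuous_intros)
  moreover have "((\<lambda>t. integral bump_box (\<lambda>z. F (z + t *\<^sub>R e))) has_field_derivative 0) (at 0 within ball 0 1)"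
    by (rule has_field_derivative_transform_within_open[where S = "ball 0 1" and f = "\<lambda>_. integral bump_box F",
          THEN DERIV_subset])
      (use e in \<open>auto simp: integral_bump_box_translation[OF cF supp]\<close>)
  ultimately show ?thesis
    by (simp add: at_within_open[of 0 "ball 0 1"] DERIV_unique)
qed

section \<open>Gradients and continuity of C1 functions\<close>

lemma has_derivative_gradient:
  "u differentiable (at x) \<Longrightarrow> (u has_derivative (\<lambda>h. h \<bullet> gradient u x)) (at x)"
  using GDERIV_gradient unfolding gderiv_def by blast


lemma C1_fun_continuous:
  "C1_fun u \<Longrightarrow> continuous_on S p \<Longrightarrow> continuous_on S (\<lambda>x. u (p x))"
  unfolding C1_fun_def
  by (rule continuous_on_compose2[of UNIV u])
    (auto intro: differentiable_imp_continuous_on simp: differentiable_on_def)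

lemma C1_fun_continuous_partial:
  "C1_fun u \<Longrightarrow> continuous_on S p \<Longrightarrow> continuous_on S (\<lambda>x. partial_deriv i u (p x))"
  unfolding C1_fun_def by (rule continuous_on_compose2[of UNIV]) auto

lemma C1_fun_continuous_gradient:
  "C1_fun u \<Longrightarrow> continuous_on S p \<Longrightarrow> continuous_on S (\<lambda>x. gradient u (p x))"
  unfolding gradient_def by (intro continuous_intros C1_fun_continuous_partial)

section \<open>Weighted means and their derivative in the radius\<close>

lemma integrable_on_bump_box: "continuous_on UNIV f \<Longrightarrow> f integrable_on bump_box"
  for f :: "real^'n \<Rightarrow> real"
  unfolding bump_box_def by (intro integrable_continuous) (rule continuous_on_subset, auto)

text \<open>A continuous nonnegative function with integral 0 over the box would vanish on it, but
  \<open>bump 0\<close> is 1.\<close>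

lemma integral_bump_pos: "0 < integral bump_box (bump :: real^'n \<Rightarrow> real)"
proof -
  have int: "bump integrable_on (bump_box :: (real^'n) set)"
    by (intro integrable_on_bump_box continuous_intros)
  then have "0 \<le> integral bump_box (bump :: real^'n \<Rightarrow> real)"
    by (rule integral_nonneg) (rule bump_nonneg)
  moreover have "integral bump_box (bump :: real^'n \<Rightarrow> real) \<noteq> 0"
  proof
    assume "integral bump_box (bump :: real^'n \<Rightarrow> real) = 0"
    with int have "(bump has_integral 0) (bump_box :: (real^'n) set)"
      by (metis integrable_integral)
    then have "bump (0::real^'n) = 0"
      unfolding bump_box_def
      by (rule has_integral_0_cbox_imp_0[rotated 2])
        (auto intro!: continuous_intros bump_nonneg simp: mem_box box_eq_empty)
    then show False
      by (simp add: bump_def)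
  qed
  ultimately show ?thesis
    by simp
qed

text \<open>Up to the constant factor \<open>integral bump_box bump\<close> this is a weighted mean
  of \<open>w\<close> over the ball of radius r around x. Rescaling to a fixed domain leaves r only
  in the integrand, so it can be differentiated in r, and r = 0 is allowed.\<close>

definition bump_mean :: "(real^'n \<Rightarrow> real) \<Rightarrow> real^'n \<Rightarrow> real \<Rightarrow> real" where
  "bump_mean w x r = integral bump_box (\<lambda>z. w (x + r *\<^sub>R z) * bump z)"

lemma bump_mean_0:
  fixes w :: "real^'n \<Rightarrow> real"
  shows "bump_mean w x 0 = w x * integral bump_box (bump :: real^'n \<Rightarrow> real)"
  by (simp add: bump_mean_def)

lemma has_field_derivative_along_ray:
  fixes w :: "real^'n \<Rightarrow> real"
  assumes "C1_fun w"
  shows "((\<lambda>r. w (x + r *\<^sub>R z)) has_field_derivative z \<bullet> gradient w (x + r *\<^sub>R z)) (at r)"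
proof -
  have *: "((\<lambda>r. x + r *\<^sub>R z) has_derivative (\<lambda>s. s *\<^sub>R z)) (at r)"
    by (auto intro!: derivative_eq_intros)
  have "w differentiable (at (x + r *\<^sub>R z))"
    using assms by (simp add: C1_fun_def)
  from has_derivative_compose[OF * has_derivative_gradient[OF this]] show ?thesis
    by (simp add: has_field_derivative_def mult_commute_abs)
qed

lemma DERIV_bump_mean_gradient:
  fixes w :: "real^'n \<Rightarrow> real"
  assumes w: "C1_fun w"
  shows "(bump_mean w x has_field_derivative
    integral bump_box (\<lambda>z. (z \<bullet> gradient w (x + r *\<^sub>R z)) * bump z)) (at r)"
proof -
  have "((\<lambda>r. integral bump_box (\<lambda>z. w (x + r *\<^sub>R z) * bump z)) has_field_derivative
    integral bump_box (\<lambda>z. (z \<bullet> gradient w (x + r *\<^sub>R z)) * bump z)) (at r within UNIV)"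
    unfolding bump_box_def
  proof (rule leibniz_rule_field_derivative)
    show "((\<lambda>r. w (x + r *\<^sub>R z) * bump z) has_field_derivative
        (z \<bullet> gradient w (x + r *\<^sub>R z)) * bump z) (at r within UNIV)" for r z
      by (rule DERIV_cmult_right) (use has_field_derivative_along_ray[OF w] in simp)
    show "continuous_on (UNIV \<times> cbox (- 2 *\<^sub>R One) (2 *\<^sub>R One))
        (\<lambda>(r, z). (z \<bullet> gradient w (x + r *\<^sub>R z)) * bump z)"
      unfolding case_prod_unfold
      by (intro continuous_intros C1_fun_continuous_gradient w)
    show "(\<lambda>z. w (x + r *\<^sub>R z) * bump z) integrable_on cbox (- 2 *\<^sub>R One) (2 *\<^sub>R One)" for r
      by (intro integrable_continuous continuous_intros C1_fun_continuous[OF w])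
  qed auto
  then show ?thesis
    by (simp add: bump_mean_def[abs_def])
qed

text \<open>Integration by parts works because \<open>4 * bump z *\<^sub>R z\<close> is minus the gradient of
  \<open>(bump z)\<^sup>2\<close>.\<close>

lemma DERIV_bump_mean:
  fixes w :: "real^'n \<Rightarrow> real"
  assumes w: "C2_fun w"
  shows "(bump_mean w x has_field_derivative
    r / 4 * integral bump_box (\<lambda>z. laplacian w (x + r *\<^sub>R z) * (bump z)\<^sup>2)) (at r)"
proof -
  have w1: "C1_fun w" and w2: "C1_fun (partial_deriv i w)" for i
    using w by (auto simp: C2_fun_def)
  \<comment> \<open>\<open>G i\<close> is the i-th partial derivative in z of
    \<open>partial_deriv i w (x + r *\<^sub>R z) * (bump z)\<^sup>2\<close>, so its integral
    vanishes.\<close>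
  define G where "G i z = r * (partial_deriv i (partial_deriv i w) (x + r *\<^sub>R z) * (bump z)\<^sup>2)
    - 4 * (z $ i * partial_deriv i w (x + r *\<^sub>R z) * bump z)" for i z
  have contG: "continuous_on UNIV (G i)" for i
    unfolding G_def[abs_def]
    by (intro continuous_intros C1_fun_continuous_partial w1 w2)
  have "integral bump_box (G i) = 0" for i
  proof -
    let ?D = "\<lambda>z h. (r *\<^sub>R h) \<bullet> gradient (partial_deriv i w) (x + r *\<^sub>R z) * (bump z)\<^sup>2
      + partial_deriv i w (x + r *\<^sub>R z) * (- 4 * bump z * (z \<bullet> h))"
    have G_eq: "?D z (axis i 1) = G i z" for z
      by (simp add: G_def inner_axis inner_axis' gradient_def)
    have "((\<lambda>z. partial_deriv i w (x + r *\<^sub>R z) * (bump z)\<^sup>2) has_derivative ?D z) (at z)" for z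
    proof -
      have *: "((\<lambda>z. x + r *\<^sub>R z) has_derivative (\<lambda>h. r *\<^sub>R h)) (at z)"
        by (auto intro!: derivative_eq_intros)
      have "partial_deriv i w differentiable (at (x + r *\<^sub>R z))"
        using w2 by (simp add: C1_fun_def)
      from has_derivative_mult[OF has_derivative_compose[OF * has_derivative_gradient[OF this]]
          has_derivative_bump_square]
      show ?thesis
        by (simp add: algebra_simps)
    qed
    then have "integral bump_box (\<lambda>z. ?D z (axis i 1)) = 0"
    proof (rule integral_directional_deriv_eq_0)
      show "continuous_on UNIV (\<lambda>z. ?D z (axis i 1))"
        unfolding G_eq by (rule contG)
    qed (simp_all add: bump_eq_0)
    then show ?thesis
      by (simp only: G_eq)
  qed
  \<comment> \<open>Summing over the coordinates turns the second partials into the Laplacian and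
    the first partials into the radial derivative of \<open>w\<close>, which is the derivative of
    the mean.\<close>
  then have "0 = (\<Sum>i\<in>UNIV. integral bump_box (G i))"
    by simp
  also have "\<dots> = integral bump_box (\<lambda>z. \<Sum>i\<in>UNIV. G i z)"
    by (rule integral_sum[symmetric]) (auto intro!: integrable_on_bump_box contG)
  also have "\<dots> = integral bump_box (\<lambda>z. r * (laplacian w (x + r *\<^sub>R z) * (bump z)\<^sup>2)
      - 4 * ((z \<bullet> gradient w (x + r *\<^sub>R z)) * bump z))"
    by (simp add: G_def laplacian_def gradient_def inner_vec_def sum_subtractf
        sum_distrib_left sum_distrib_right)
  also have "\<dots> = r * integral bump_box (\<lambda>z. laplacian w (x + r *\<^sub>R z) * (bump z)\<^sup>2)
      - 4 * integral bump_box (\<lambda>z. (z \<bullet> gradient w (x + r *\<^sub>R z)) * bump z)"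
    unfolding laplacian_def integral_mult_right[symmetric]
    by (rule integral_diff)
      (intro integrable_on_bump_box continuous_intros C1_fun_continuous_partial
        C1_fun_continuous_gradient w1 w2)+
  finally have "integral bump_box (\<lambda>z. (z \<bullet> gradient w (x + r *\<^sub>R z)) * bump z) =
      r / 4 * integral bump_box (\<lambda>z. laplacian w (x + r *\<^sub>R z) * (bump z)\<^sup>2)"
    by simp
  with DERIV_bump_mean_gradient[OF w1, of x r] show ?thesis
    by simp
qed

section \<open>Mean value inequalities\<close>

lemma C2_fun_laplacian_integrable:
  fixes w :: "real^'n \<Rightarrow> real"
  assumes "C2_fun w"
  shows "(\<lambda>z. laplacian w (x + r *\<^sub>R z) * (bump z)\<^sup>2) integrable_on bump_box"
  using assms unfolding C2_fun_def laplacian_def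
  by (intro integrable_on_bump_box continuous_intros C1_fun_continuous_partial) auto

text \<open>By \<open>DERIV_bump_mean\<close> the sign of the Laplacian makes the mean nondecreasing
  in the radius. The left-hand side is its value at radius 0.\<close>

lemma subharmonic_le_bump_mean:
  fixes w :: "real^'n \<Rightarrow> real"
  assumes w: "C2_fun w" and lap: "\<And>x. 0 \<le> laplacian w x" and "0 \<le> r"
  shows "w x * integral bump_box (bump :: real^'n \<Rightarrow> real) \<le> bump_mean w x r"
proof -
  have nonneg: "0 \<le> integral bump_box (\<lambda>z. laplacian w (x + s *\<^sub>R z) * (bump z)\<^sup>2)" for s
    by (intro integral_nonneg C2_fun_laplacian_integrable w) (simp add: lap)
  have "bump_mean w x 0 \<le> bump_mean w x r"
  proof (rule DERIV_nonneg_imp_nondecreasing[OF \<open>0 \<le> r\<close>], intro exI conjI)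
    fix s :: real assume "0 \<le> s"
    then show "0 \<le> s / 4 * integral bump_box (\<lambda>z. laplacian w (x + s *\<^sub>R z) * (bump z)\<^sup>2)"
      using nonneg by (intro mult_nonneg_nonneg) auto
  qed (rule DERIV_bump_mean[OF w])
  then show ?thesis
    by (simp add: bump_mean_0)
qed

lemma superharmonic_ge_bump_mean:
  fixes w :: "real^'n \<Rightarrow> real"
  assumes w: "C2_fun w" and lap: "\<And>x. laplacian w x \<le> 0" and "0 \<le> r"
  shows "bump_mean w x r \<le> w x * integral bump_box (bump :: real^'n \<Rightarrow> real)"
proof -
  have neg: "integral bump_box (\<lambda>z. laplacian w (x + s *\<^sub>R z) * (bump z)\<^sup>2) \<le> 0" for s
    using integral_le[OF C2_fun_laplacian_integrable[OF w] integrable_0]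
    by (simp add: mult_nonpos_nonneg lap)
  have "bump_mean w x r \<le> bump_mean w x 0"
  proof (rule DERIV_nonpos_imp_nonincreasing[OF \<open>0 \<le> r\<close>], intro exI conjI)
    fix s :: real assume "0 \<le> s"
    then show "s / 4 * integral bump_box (\<lambda>z. laplacian w (x + s *\<^sub>R z) * (bump z)\<^sup>2) \<le> 0"
      using neg by (intro mult_nonneg_nonpos) auto
  qed (rule DERIV_bump_mean[OF w])
  then show ?thesis
    by (simp add: bump_mean_0)
qed

section \<open>Dependence of the means on the centre\<close>

lemma bump_diff_le: "\<bar>bump z - bump z'\<bar> \<le> norm (z - z') * (norm z + norm z')"
proof -
  \<comment> \<open>Truncation at 0 does not increase distances.\<close>
  have "\<bar>bump z - bump z'\<bar> \<le> \<bar>z \<bullet> z - z' \<bullet> z'\<bar>"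
    by (auto simp: bump_def max_def)
  also have "z \<bullet> z - z' \<bullet> z' = (z - z') \<bullet> (z + z')"
    by (simp add: inner_diff_left inner_add_right inner_commute[of z z'])
  also have "\<bar>\<dots>\<bar> \<le> norm (z - z') * norm (z + z')"
    by (rule Cauchy_Schwarz_ineq2)
  also have "\<dots> \<le> norm (z - z') * (norm z + norm z')"
    by (intro mult_left_mono norm_triangle_ineq) auto
  finally show ?thesis .
qed

text \<open>After rescaling, moving the centre from x to y amounts to translating the weight by (y -
  x)/r. The weight is Lipschitz on bounded sets and \<open>w\<close> is bounded, so the means differ
  by O(1/r).\<close>

lemma bump_mean_diff_bound:
  fixes w :: "real^'n \<Rightarrow> real"
  assumes cont: "continuous_on UNIV w" and bound: "\<And>x. \<bar>w x\<bar> \<le> S"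
  obtains C where "\<And>r. 0 < r \<Longrightarrow> norm (y - x) \<le> r \<Longrightarrow> \<bar>bump_mean w y r - bump_mean w x r\<bar> \<le> C / r"
proof -
  have "bounded (bump_box :: (real^'n) set)"
    by (simp add: bump_box_def)
  then obtain N where N: "\<And>z. z \<in> bump_box \<Longrightarrow> norm (z::real^'n) \<le> N"
    by (auto simp: bounded_iff)
  \<comment> \<open>The integrand is bounded by S times |y - x|/r times 2N + 1, and the last factor
    of C is the volume of the box. For z in the box, N bounds |z| and N + 1 bounds |z - h|.\<close>
  define C where "C = S * (norm (y - x) * (2 * N + 1)) * measure lborel (bump_box :: (real^'n) set)"
  have "0 \<le> S"
    using bound[of 0] by linarith
  have "\<bar>bump_mean w y r - bump_mean w x r\<bar> \<le> C / r" if r: "0 < r" "norm (y - x) \<le> r" for r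
  proof -
    define h where "h = (y - x) /\<^sub>R r"
    have h: "norm h = norm (y - x) / r" "norm h \<le> 1"
      using r by (auto simp: h_def divide_simps)
    have cw: "continuous_on UNIV (\<lambda>z. w (q + r *\<^sub>R z))" for q
      by (rule continuous_on_compose2[OF cont]) (auto intro!: continuous_intros)
    \<comment> \<open>Replacing z by z - h turns y + r z into x + r z and leaves the shift on the
      weight alone. The restriction |y - x| \<le> r ensures |h| \<le> 1, as the translation lemma
      requires.\<close>
    have "bump_mean w y r = integral bump_box (\<lambda>z. w (y + r *\<^sub>R (z + - h)) * bump (z + - h))"
      unfolding bump_mean_def
      by (rule integral_bump_box_translation[symmetric])
        (use h in \<open>auto simp: bump_eq_0 intro!: continuous_intros cw\<close>)
    also have "\<dots> = integral bump_box (\<lambda>z. w (x + r *\<^sub>R z) * bump (z - h))"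
      using r by (simp add: h_def algebra_simps)
    finally have "bump_mean w y r - bump_mean w x r =
        integral bump_box (\<lambda>z. w (x + r *\<^sub>R z) * bump (z - h) - w (x + r *\<^sub>R z) * bump z)"
      unfolding bump_mean_def
      by (simp add: integral_diff[OF integrable_on_bump_box integrable_on_bump_box] cw continuous_intros)
    also have "norm \<dots> \<le> integral bump_box (\<lambda>z::real^'n. S * (norm (y - x) * (2 * N + 1)) / r)"
    proof (rule integral_norm_bound_integral)
      fix z :: "real^'n"
      assume z: "z \<in> bump_box"
      have "norm (z - h) \<le> norm z + norm h"
        by (rule norm_triangle_ineq4)
      then have "norm (z - h) + norm z \<le> 2 * N + 1"
        using N[OF z] h(2) by linarith
      then have "norm h * (norm (z - h) + norm z) \<le> norm h * (2 * N + 1)"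
        by (rule mult_left_mono) simp
      moreover have "\<bar>bump (z - h) - bump z\<bar> \<le> norm h * (norm (z - h) + norm z)"
        using bump_diff_le[of "z - h" z] by simp
      ultimately have "\<bar>bump (z - h) - bump z\<bar> \<le> norm h * (2 * N + 1)"
        by linarith
      then have "\<bar>w (x + r *\<^sub>R z)\<bar> * \<bar>bump (z - h) - bump z\<bar> \<le> S * (norm h * (2 * N + 1))"
        by (intro mult_mono bound \<open>0 \<le> S\<close>) auto
      then show "norm (w (x + r *\<^sub>R z) * bump (z - h) - w (x + r *\<^sub>R z) * bump z)
          \<le> S * (norm (y - x) * (2 * N + 1)) / r"
        by (simp add: h(1) flip: abs_mult right_diff_distrib)
    qed (intro integrable_on_bump_box continuous_intros cw)+
    also have "\<dots> = C / r"
      by (simp add: C_def bump_box_def)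
    finally show ?thesis
      by simp
  qed
  with that show ?thesis
    by blast
qed

section \<open>Derivatives and Laplacian of powers\<close>

lemma has_derivative_power_fun:
  fixes u :: "real^'n \<Rightarrow> real"
  assumes "u differentiable (at x)"
  shows "((\<lambda>x. u x ^ Suc k) has_derivative (\<lambda>h. real (Suc k) * u x ^ k * (h \<bullet> gradient u x))) (at x)"
  by (rule has_derivative_eq_rhs[OF has_derivative_power[OF has_derivative_gradient[OF assms]]])
    (simp add: fun_eq_iff)

lemma partial_deriv_power:
  fixes u :: "real^'n \<Rightarrow> real"
  assumes "C1_fun u"
  shows "partial_deriv i (\<lambda>x. u x ^ Suc k) = (\<lambda>x. real (Suc k) * u x ^ k * partial_deriv i u x)"
proof
  fix x
  have "u differentiable (at x)"
    using assms by (simp add: C1_fun_def)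
  from has_derivative_imp_partial_deriv[OF has_derivative_power_fun[OF this]]
  show "partial_deriv i (\<lambda>x. u x ^ Suc k) x = real (Suc k) * u x ^ k * partial_deriv i u x"
    by (simp add: inner_axis' gradient_def del: power_Suc)
qed

lemma C1_fun_power:
  assumes "C1_fun u"
  shows "C1_fun (\<lambda>x. u x ^ Suc k)"
  unfolding C1_fun_def partial_deriv_power[OF assms]
  using assms C1_fun_continuous_partial[OF assms continuous_on_id] C1_fun_continuous[OF assms continuous_on_id]
  by (auto simp: C1_fun_def intro!: continuous_intros differentiableI[OF has_derivative_power_fun])

text \<open>The shape \<open>c * u x * v x\<close> is that of the right-hand side of
  \<open>partial_deriv_power\<close>, so the second partials of a power follow by rewriting.\<close>

lemma has_derivative_mult_fun:
  fixes u v :: "real^'n \<Rightarrow> real"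
  assumes "u differentiable (at x)" "v differentiable (at x)"
  shows "((\<lambda>x. c * u x * v x) has_derivative
    (\<lambda>h. c * (u x * (h \<bullet> gradient v x) + (h \<bullet> gradient u x) * v x))) (at x)"
  using has_derivative_mult_right[OF has_derivative_mult[OF assms[THEN has_derivative_gradient]], of c]
  by (simp only: mult.assoc)

lemma partial_deriv_mult:
  fixes u v :: "real^'n \<Rightarrow> real"
  assumes "C1_fun u" "C1_fun v"
  shows "partial_deriv i (\<lambda>x. c * u x * v x) =
    (\<lambda>x. c * (u x * partial_deriv i v x + partial_deriv i u x * v x))"
  using assms
  by (auto simp: C1_fun_def fun_eq_iff inner_axis' gradient_def
      has_derivative_imp_partial_deriv[OF has_derivative_mult_fun])

lemma C1_fun_mult:
  assumes "C1_fun u" "C1_fun v"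
  shows "C1_fun (\<lambda>x. c * u x * v x)"
  unfolding C1_fun_def partial_deriv_mult[OF assms]
  using assms C1_fun_continuous_partial[OF assms(1) continuous_on_id] C1_fun_continuous[OF assms(1) continuous_on_id]
    C1_fun_continuous_partial[OF assms(2) continuous_on_id] C1_fun_continuous[OF assms(2) continuous_on_id]
  by (auto simp: C1_fun_def intro!: continuous_intros differentiableI[OF has_derivative_mult_fun])

text \<open>With exponent k + 2, the first partials contain the power k + 1, which
  \<open>C1_fun_power\<close> covers.\<close>

lemma C2_fun_power:
  assumes "C2_fun u"
  shows "C2_fun (\<lambda>x. u x ^ Suc (Suc k))"
  using assms C1_fun_power[of u] by (simp add: C2_fun_def partial_deriv_power C1_fun_mult del: power_Suc of_nat_Suc)

text \<open>Pulling out \<open>u x ^ k\<close> leaves a bracket that the growth condition bounds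
  below by 0 once k + 1 \<ge> K.\<close>

lemma laplacian_power:
  fixes u :: "real^'n \<Rightarrow> real"
  assumes "C2_fun u"
  shows "laplacian (\<lambda>x. u x ^ Suc (Suc k)) x =
    real (Suc (Suc k)) * u x ^ k * (u x * laplacian u x + real (Suc k) * (norm (gradient u x))\<^sup>2)"
proof -
  have u1: "C1_fun u" and u2: "C1_fun (partial_deriv i u)" for i
    using assms by (auto simp: C2_fun_def)
  have "partial_deriv i (partial_deriv i (\<lambda>x. u x ^ Suc (Suc k))) x =
    real (Suc (Suc k)) * u x ^ k * (u x * partial_deriv i (partial_deriv i u) x
      + real (Suc k) * (partial_deriv i u x)\<^sup>2)" for i
    unfolding partial_deriv_power[OF u1] partial_deriv_mult[OF C1_fun_power[OF u1] u2]
    by (simp add: algebra_simps power2_eq_square)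
  then show ?thesis
    by (simp add: laplacian_def gradient_def power2_norm_eq_inner inner_vec_def sum_distrib_left
        sum.distrib distrib_left flip: power2_eq_square)
qed

section \<open>Liouville theorem for a single superharmonic function\<close>

lemma liouville_superharmonic:
  fixes u :: "real^'n \<Rightarrow> real"
  assumes u: "C2_fun u" and nonneg: "\<And>x. 0 \<le> u x" and bdd: "bounded (range u)"
    and super: "\<And>x. laplacian u x \<le> 0"
    and growth: "\<And>x. u x * - laplacian u x \<le> K * (norm (gradient u x))\<^sup>2"
  shows "u constant_on UNIV"
proof -
  have bdd': "bdd_above (range u)"
    using bdd by (rule bounded_imp_bdd_above)
  define S where "S = (SUP x. u x)"
  have le_S: "u x \<le> S" for x
    unfolding S_def using bdd' by (rule cSUP_upper2) auto
  have "0 \<le> S"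
    using order_trans[OF nonneg le_S] .
  \<comment> \<open>The exponent of the subharmonic power will be m = k + 2, so m - 1 = k + 1
    exceeds K.\<close>
  obtain k where k: "K \<le> real k"
    using real_arch_simple by blast
  define w where "w x = u x ^ Suc (Suc k)" for x
  have w: "C2_fun w"
    unfolding w_def[abs_def] using u by (rule C2_fun_power)
  have sub: "0 \<le> laplacian w x" for x
  proof -
    have "K * (norm (gradient u x))\<^sup>2 \<le> real (Suc k) * (norm (gradient u x))\<^sup>2"
      using k by (intro mult_right_mono) auto
    with growth[of x] have "0 \<le> u x * laplacian u x + real (Suc k) * (norm (gradient u x))\<^sup>2"
      by simp
    then show ?thesis
      unfolding w_def[abs_def] laplacian_power[OF u] by (intro mult_nonneg_nonneg nonneg zero_le_power) auto
  qed
  define I where "I = integral bump_box (bump :: real^'n \<Rightarrow> real)"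
  have "0 < I"
    unfolding I_def by (rule integral_bump_pos)
  have cont: "continuous_on UNIV (\<lambda>z. u (q + r *\<^sub>R z))" for q r
    using u by (auto simp: C2_fun_def intro!: C1_fun_continuous continuous_intros)
  have key: "u y ^ Suc (Suc k) \<le> S ^ Suc k * u x" for x y
  proof -
    obtain C where C: "\<bar>bump_mean u y r - bump_mean u x r\<bar> \<le> C / r"
      if "0 < r" "norm (y - x) \<le> r" for r
      \<comment> \<open>The instance \<open>cont[of 0 1]\<close> simplifies to continuity of
        \<open>u\<close> itself.\<close>
      using bump_mean_diff_bound[of u S y x] cont[of 0 1] nonneg le_S by auto
    have mean_bound: "w y * I \<le> S ^ Suc k * (u x * I + C / r)" if r: "0 < r" "norm (y - x) \<le> r" for r
    proof -
      \<comment> \<open>The chain uses the subharmonic inequality for \<open>w\<close> at y, the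
        pointwise bound of \<open>w\<close> by a multiple of \<open>u\<close>, the change of centre
        from y to x, and the superharmonic inequality for \<open>u\<close> at x.\<close>
      have "w y * I \<le> bump_mean w y r"
        unfolding I_def using r by (intro subharmonic_le_bump_mean w sub) auto
      also have "\<dots> \<le> integral bump_box (\<lambda>z. S ^ Suc k * (u (y + r *\<^sub>R z) * bump z))"
        unfolding bump_mean_def
      proof (rule integral_le)
        fix z
        have "u (y + r *\<^sub>R z) ^ Suc k * (u (y + r *\<^sub>R z) * bump z) \<le> S ^ Suc k * (u (y + r *\<^sub>R z) * bump z)"
          by (intro mult_right_mono power_mono le_S nonneg mult_nonneg_nonneg bump_nonneg)
        then show "w (y + r *\<^sub>R z) * bump z \<le> S ^ Suc k * (u (y + r *\<^sub>R z) * bump z)"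
          by (simp add: w_def mult_ac)
      qed (unfold w_def, (intro integrable_on_bump_box continuous_intros cont)+)
      also have "\<dots> = S ^ Suc k * bump_mean u y r"
        by (simp add: bump_mean_def)
      also have "\<dots> \<le> S ^ Suc k * (bump_mean u x r + C / r)"
        using C[OF r] \<open>0 \<le> S\<close> by (intro mult_left_mono) auto
      also have "\<dots> \<le> S ^ Suc k * (u x * I + C / r)"
        unfolding I_def using r \<open>0 \<le> S\<close>
        by (intro mult_left_mono add_right_mono superharmonic_ge_bump_mean u super) auto
      finally show ?thesis .
    qed
    \<comment> \<open>Letting r tend to infinity removes the error C/r, and the positive factor
      \<open>I\<close> then cancels.\<close>
    have "\<forall>\<^sub>F r in at_top. w y * I \<le> S ^ Suc k * (u x * I + C / r)"
      using eventually_gt_at_top[of 0] eventually_ge_at_top[of "norm (y - x)"]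
      by eventually_elim (rule mean_bound)
    moreover have "((\<lambda>r. S ^ Suc k * (u x * I + C / r)) \<longlongrightarrow> S ^ Suc k * (u x * I + 0)) at_top"
      by (intro tendsto_intros real_tendsto_divide_at_top[OF tendsto_const] filterlim_ident)
    ultimately have "w y * I \<le> S ^ Suc k * (u x * I + 0)"
      by (intro tendsto_lowerbound) auto
    with \<open>0 < I\<close> show ?thesis
      by (simp add: w_def)
  qed
  have "u x = S" for x
  proof (rule antisym[OF le_S])
    show "S \<le> u x"
    proof (rule ccontr)
      assume less: "\<not> S \<le> u x"
      then have "0 < S"
        using nonneg[of x] by linarith
      \<comment> \<open>The supremum need not be known to be attained. If u(x) < S, the strict
        inequality between S^(k+1) u(x) and S^(k+2) persists for s slightly below S in place of S in
        the power, and a point y with u(y) > s contradicts \<open>key\<close>.\<close>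
      have "((\<lambda>s. s ^ Suc (Suc k)) \<longlongrightarrow> S ^ Suc (Suc k)) (at_left S)"
        by (intro tendsto_intros)
      moreover have "S ^ Suc k * u x < S ^ Suc (Suc k)"
        using less \<open>0 < S\<close> by (simp add: mult.commute)
      ultimately have "\<forall>\<^sub>F s in at_left S. S ^ Suc k * u x < s ^ Suc (Suc k)"
        by (rule order_tendstoD)
      moreover have "\<forall>\<^sub>F s in at_left S. 0 < s \<and> s < S"
        using eventually_at_left_real[OF \<open>0 < S\<close>] by eventually_elim simp
      ultimately have "\<forall>\<^sub>F s in at_left S. S ^ Suc k * u x < s ^ Suc (Suc k) \<and> 0 < s \<and> s < S"
        by (rule eventually_conj)
      then obtain s where s: "S ^ Suc k * u x < s ^ Suc (Suc k)" "0 < s" "s < S"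
        using eventually_happens'[OF trivial_limit_at_left_real] by blast
      obtain y where "s < u y"
        using s(3) bdd' unfolding S_def by (subst (asm) less_cSUP_iff) auto
      then have "s ^ Suc (Suc k) \<le> u y ^ Suc (Suc k)"
        using s(2) by (intro power_mono) auto
      with key[of y x] s(1) show False
        by linarith
    qed
  qed
  then show ?thesis
    by (auto simp: constant_on_def)
qed

section \<open>Application to the system\<close>

text \<open>The growth bound is assumed only along the solution, where both forms of the hypothesis
  supply it with one K. The system then decouples: nonnegativity of f and g makes each component
  superharmonic, and \<open>liouville_superharmonic\<close> applies to each separately.\<close>

lemma solution_constant_if_growth:
  fixes u v :: "real^'n \<Rightarrow> real"
  assumes sol: "nonneg_classical_solution f g u v" and "bounded (range u)" "bounded (range v)"
    and f_nonneg: "\<And>x s t \<xi> \<zeta>. 0 \<le> s \<Longrightarrow> 0 \<le> t \<Longrightarrow> 0 \<le> f x s t \<xi> \<zeta>"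
    and g_nonneg: "\<And>x s t \<xi> \<zeta>. 0 \<le> s \<Longrightarrow> 0 \<le> t \<Longrightarrow> 0 \<le> g x s t \<xi> \<zeta>"
    and growth: "\<And>x. u x * f x (u x) (v x) (gradient u x) (gradient v x) \<le> K * (norm (gradient u x))\<^sup>2 \<and>
      v x * g x (u x) (v x) (gradient u x) (gradient v x) \<le> K * (norm (gradient v x))\<^sup>2"
  shows "u constant_on UNIV \<and> v constant_on UNIV"
proof -
  have C2: "C2_fun u" "C2_fun v" and nonneg: "\<And>x. 0 \<le> u x" "\<And>x. 0 \<le> v x"
    and eq: "\<And>x. - laplacian u x = f x (u x) (v x) (gradient u x) (gradient v x)"
      "\<And>x. - laplacian v x = g x (u x) (v x) (gradient u x) (gradient v x)"
    using sol unfolding nonneg_classical_solution_def by blast+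
  have super: "laplacian u x \<le> 0" "laplacian v x \<le> 0" for x
    using eq[of x] f_nonneg[OF nonneg[of x], of x "gradient u x" "gradient v x"]
      g_nonneg[OF nonneg[of x], of x "gradient u x" "gradient v x"]
    by linarith+
  have "u x * - laplacian u x \<le> K * (norm (gradient u x))\<^sup>2"
    "v x * - laplacian v x \<le> K * (norm (gradient v x))\<^sup>2" for x
    unfolding eq using growth by auto
  with super show ?thesis
    by (intro conjI liouville_superharmonic[where K = K] C2 nonneg assms(2,3))
qed

theorem theorem1p2:
  fixes f g :: "real^'n \<Rightarrow> real \<Rightarrow> real \<Rightarrow> real^'n \<Rightarrow> real^'n \<Rightarrow> real"
  assumes f_nonneg: "\<And>x s t \<xi> \<zeta>. 0 \<le> s \<Longrightarrow> 0 \<le> t \<Longrightarrow> 0 \<le> f x s t \<xi> \<zeta>"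
    and g_nonneg: "\<And>x s t \<xi> \<zeta>. 0 \<le> s \<Longrightarrow> 0 \<le> t \<Longrightarrow> 0 \<le> g x s t \<xi> \<zeta>"
  shows
    "((\<forall>M>0. \<exists>K>0. \<forall>x. \<forall>s\<in>{0..M}. \<forall>t\<in>{0..M}. \<forall>\<xi> \<zeta>.
         s * f x s t \<xi> \<zeta> \<le> K * (norm \<xi>)\<^sup>2 \<and> t * g x s t \<xi> \<zeta> \<le> K * (norm \<zeta>)\<^sup>2) \<longrightarrow>
      (\<forall>u v. nonneg_classical_solution f g u v \<and> bounded (range u) \<and> bounded (range v) \<longrightarrow>
         u constant_on UNIV \<and> v constant_on UNIV)) \<and>
     ((\<forall>M>0. \<exists>K>0. \<forall>x. \<forall>s\<in>{0..M}. \<forall>t\<in>{0..M}. \<forall>\<xi>\<in>ball 0 M. \<forall>\<zeta>\<in>ball 0 M.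
         s * f x s t \<xi> \<zeta> \<le> K * (norm \<xi>)\<^sup>2 \<and> t * g x s t \<xi> \<zeta> \<le> K * (norm \<zeta>)\<^sup>2) \<longrightarrow>
      (\<forall>u v. nonneg_classical_solution f g u v \<and> bounded (range u) \<and> bounded (range v) \<and>
           bounded (range (\<lambda>x. norm (gradient u x))) \<and> bounded (range (\<lambda>x. norm (gradient v x))) \<longrightarrow>
         u constant_on UNIV \<and> v constant_on UNIV))"
proof (intro conjI impI allI; elim conjE)
  fix u v
  assume growth: "\<forall>M>0. \<exists>K>0. \<forall>x. \<forall>s\<in>{0..M}. \<forall>t\<in>{0..M}. \<forall>\<xi> \<zeta>.
      s * f x s t \<xi> \<zeta> \<le> K * (norm \<xi>)\<^sup>2 \<and> t * g x s t \<xi> \<zeta> \<le> K * (norm \<zeta>)\<^sup>2"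
    and sol: "nonneg_classical_solution f g u v"
    and bdd: "bounded (range u)" "bounded (range v)"
  have nonneg: "0 \<le> u x" "0 \<le> v x" for x
    using sol by (simp_all only: nonneg_classical_solution_def)
  obtain A B where "\<And>x. \<bar>u x\<bar> \<le> A" "\<And>x. \<bar>v x\<bar> \<le> B"
    using bdd by (auto simp: bounded_iff)
  \<comment> \<open>The maximum with 1 makes the chosen M positive, as the growth hypothesis
    requires.\<close>
  then have range: "u x \<in> {0..max 1 (max A B)}" "v x \<in> {0..max 1 (max A B)}" for x
    using nonneg[of x] by (auto simp: le_max_iff_disj abs_le_iff)
  have "0 < max 1 (max A B)"
    by simp
  with growth obtain K where "\<forall>x. \<forall>s\<in>{0..max 1 (max A B)}. \<forall>t\<in>{0..max 1 (max A B)}. \<forall>\<xi> \<zeta>.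
      s * f x s t \<xi> \<zeta> \<le> K * (norm \<xi>)\<^sup>2 \<and> t * g x s t \<xi> \<zeta> \<le> K * (norm \<zeta>)\<^sup>2"
    by meson
  then have "u x * f x (u x) (v x) (gradient u x) (gradient v x) \<le> K * (norm (gradient u x))\<^sup>2 \<and>
      v x * g x (u x) (v x) (gradient u x) (gradient v x) \<le> K * (norm (gradient v x))\<^sup>2" for x
    using range[of x] by meson
  from solution_constant_if_growth[OF sol bdd _ _ this]
  show "u constant_on UNIV" "v constant_on UNIV"
    using f_nonneg g_nonneg by simp_all
next
  fix u v
  assume growth: "\<forall>M>0. \<exists>K>0. \<forall>x. \<forall>s\<in>{0..M}. \<forall>t\<in>{0..M}. \<forall>\<xi>\<in>ball 0 M. \<forall>\<zeta>\<in>ball 0 M.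
      s * f x s t \<xi> \<zeta> \<le> K * (norm \<xi>)\<^sup>2 \<and> t * g x s t \<xi> \<zeta> \<le> K * (norm \<zeta>)\<^sup>2"
    and sol: "nonneg_classical_solution f g u v"
    and bdd: "bounded (range u)" "bounded (range v)"
    and grad: "bounded (range (\<lambda>x. norm (gradient u x)))" "bounded (range (\<lambda>x. norm (gradient v x)))"
  have nonneg: "0 \<le> u x" "0 \<le> v x" for x
    using sol by (simp_all only: nonneg_classical_solution_def)
  obtain A B where AB: "\<And>x. \<bar>u x\<bar> \<le> A" "\<And>x. \<bar>v x\<bar> \<le> B"
    using bdd by (auto simp: bounded_iff)
  obtain C D where CD: "\<And>x. norm (gradient u x) \<le> C" "\<And>x. norm (gradient v x) \<le> D"
    using grad by (auto simp: bounded_iff)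
  \<comment> \<open>A single M must bound both functions and both gradients. The summand 1 makes it
    positive and puts the gradients in the open ball of radius M even where their bounds are
    attained.\<close>
  define M where "M = A + B + C + D + 1"
  have "0 \<le> A" "0 \<le> B" "0 \<le> C" "0 \<le> D"
    using AB CD by (meson abs_ge_zero norm_ge_zero order_trans)+
  then have "0 < M" "A \<le> M" "B \<le> M" "C < M" "D < M"
    by (auto simp: M_def)
  then have range: "u x \<in> {0..M}" "v x \<in> {0..M}" "gradient u x \<in> ball 0 M" "gradient v x \<in> ball 0 M" for x
    using nonneg[of x] AB[of x] CD[of x] by auto
  from growth \<open>0 < M\<close> obtain K where "\<forall>x. \<forall>s\<in>{0..M}. \<forall>t\<in>{0..M}. \<forall>\<xi>\<in>ball 0 M. \<forall>\<zeta>\<in>ball 0 M.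
      s * f x s t \<xi> \<zeta> \<le> K * (norm \<xi>)\<^sup>2 \<and> t * g x s t \<xi> \<zeta> \<le> K * (norm \<zeta>)\<^sup>2"
    by meson
  then have "u x * f x (u x) (v x) (gradient u x) (gradient v x) \<le> K * (norm (gradient u x))\<^sup>2 \<and>
      v x * g x (u x) (v x) (gradient u x) (gradient v x) \<le> K * (norm (gradient v x))\<^sup>2" for x
    using range[of x] by meson
  from solution_constant_if_growth[OF sol bdd _ _ this]
  show "u constant_on UNIV" "v constant_on UNIV"
    using f_nonneg g_nonneg by simp_all
qed

end
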